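(* Let $(P,x,y)$ be a $d$-dimensional all-but-simple spindle of length $d+1$. Then every path from $x$ to $y$ in the vertex-edge graph of $P$ revisits at least one facet of $P$.
   Context: A $d$-dimensional spindle $(P,x,y)$ is a $d$-dimensional (bounded, convex) polytope $P$ with two distinguished vertices $x$ and $y$ such that every facet of $P$ is incident to either $x$ or $y$. The length of the spindle is the distance $\delta_P(x,y)$ between $x$ and $y$ in the vertex-edge graph of $P$, i.e. the minimum number of edges in an edge path from $x$ to $y$. A vertex of a $d$-dimensional polytope is simple if it is incident to exactly $d$ facets. The spindle $(P,x,y)$ is all-but-simple if every vertex of $P$ other than $x$ and $y$ is simple. A path $[u_0=x,u_1,\ldots,u_k=y]$ (a sequence of vertices of $P$ in which consecutive vertices are joined by an edge of $P$) revisits a facet $F$ if it leaves $F$ and later returns to it, i.e. there are indices $i<j<l$ with $u_i\in F$, $u_j\notin F$, $u_l\in F$. *)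

theory Defs
  imports "HOL-Analysis.Polytope" "HOL-Library.Extended_Nat"
begin

(* A polytope of dimension d is a set P with polytope P and aff_dim P = int d; the ambient space
   may have larger dimension. Vertices, edges and facets are extreme_point_of, edge_of, facet_of. *)

definition adjacent :: "'a::euclidean_space set \<Rightarrow> 'a \<Rightarrow> 'a \<Rightarrow> bool" where
  "adjacent P u v \<longleftrightarrow> u extreme_point_of P \<and> v extreme_point_of P \<and> closed_segment u v edge_of P"

(* Vertices may repeat. A path [u_0, ..., u_k] is a list with k + 1 entries and has k edges. *)
definition graph_path :: "'a::euclidean_space set \<Rightarrow> 'a \<Rightarrow> 'a list \<Rightarrow> 'a \<Rightarrow> bool" where
  "graph_path P x us y \<longleftrightarrow>
     us \<noteq> [] \<and> hd us = x \<and> last us = y \<and>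
     (\<forall>u\<in>set us. u extreme_point_of P) \<and> successively (adjacent P) us"

(* Taken in enat, so that the distance would be infinite if there were no path. *)
definition graph_dist :: "'a::euclidean_space set \<Rightarrow> 'a \<Rightarrow> 'a \<Rightarrow> enat" where
  "graph_dist P x y = (INF us\<in>{us. graph_path P x us y}. enat (length us - 1))"

definition spindle :: "nat \<Rightarrow> 'a::euclidean_space set \<Rightarrow> 'a \<Rightarrow> 'a \<Rightarrow> bool" where
  "spindle d P x y \<longleftrightarrow>
     polytope P \<and> aff_dim P = int d \<and>
     x extreme_point_of P \<and> y extreme_point_of P \<and> x \<noteq> y \<and>
     (\<forall>F. F facet_of P \<longrightarrow> x \<in> F \<or> y \<in> F)"

definition simple_vertex :: "'a::euclidean_space set \<Rightarrow> 'a \<Rightarrow> bool" where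
  "simple_vertex P v \<longleftrightarrow>
     v extreme_point_of P \<and> int (card {F. F facet_of P \<and> v \<in> F}) = aff_dim P"

definition all_but_simple :: "'a::euclidean_space set \<Rightarrow> 'a \<Rightarrow> 'a \<Rightarrow> bool" where
  "all_but_simple P x y \<longleftrightarrow>
     (\<forall>v. v extreme_point_of P \<and> v \<noteq> x \<and> v \<noteq> y \<longrightarrow> simple_vertex P v)"

definition revisits :: "'a list \<Rightarrow> 'a set \<Rightarrow> bool" where
  "revisits us F \<longleftrightarrow>
     (\<exists>i j l. i < j \<and> j < l \<and> l < length us \<and> us ! i \<in> F \<and> us ! j \<notin> F \<and> us ! l \<in> F)"

end

theory Submission
  imports Defs
begin

text \<open>
  Along a path from \<open>x\<close> to \<open>y\<close> that revisits no facet, consider at each vertex the facets that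
  contain it but not \<open>x\<close>. In a spindle such a facet contains \<open>y\<close>, so the path, which ends
  in \<open>y\<close>, cannot leave it again. On the other hand every step enters a facet, because distinct
  vertices are separated by facets (\<open>facet_separates_vertices\<close>), and a facet entered after the start
  cannot contain \<open>x\<close>. Hence after \<open>i\<close> steps there are at least \<open>i\<close> such facets
  (\<open>card_facets_avoiding_start\<close>).

  If the path has at least \<open>d + 1\<close> edges, its last vertex but one, \<open>w\<close>, therefore lies in at
  least \<open>d\<close> facets avoiding \<open>x\<close>. As \<open>w\<close> is simple these are all facets at \<open>w\<close>, and all of
  them contain \<open>y\<close>; so no facet separates \<open>w\<close> from \<open>y\<close>, which is absurd.
\<close>

text \<open>A vertex is a face, and a nonempty proper face of a polyhedron is the intersection of the
  facets that contain it.\<close>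

lemma facet_separates_vertices:
  fixes P :: "'a::euclidean_space set"
  assumes "polyhedron P" "u extreme_point_of P" "v \<in> P" "u \<noteq> v"
  obtains F where "F facet_of P" "u \<in> F" "v \<notin> F"
proof -
  have "{u} face_of P" "{u} \<noteq> P"
    using assms by (auto simp: face_of_singleton)
  then have "{u} = \<Inter>{F. F facet_of P \<and> {u} \<subseteq> F}"
    using face_of_polyhedron[OF assms(1)] by blast
  with \<open>u \<noteq> v\<close> have "v \<notin> \<Inter>{F. F facet_of P \<and> {u} \<subseteq> F}"
    by (metis singletonD)
  then show thesis using that by blast
qed

lemma adjacent_imp_neq: "adjacent P u v \<Longrightarrow> u \<noteq> v"
  by (auto simp: adjacent_def edge_of_def)

lemma card_facets_avoiding_start:
  fixes P :: "'a::euclidean_space set"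
  assumes sp: "spindle d P x y" and path: "graph_path P x us y"
    and no_revisit: "\<And>F. F facet_of P \<Longrightarrow> \<not> revisits us F"
    and "i < length us"
  shows "i \<le> card {F. F facet_of P \<and> us ! i \<in> F \<and> x \<notin> F}"
  using \<open>i < length us\<close>
proof (induction i)
  case (Suc i)
  let ?N = "\<lambda>i. {F. F facet_of P \<and> us ! i \<in> F \<and> x \<notin> F}"
  have poly: "polyhedron P"
    using sp by (simp add: spindle_def polytope_imp_polyhedron)
  have first: "us ! 0 = x" and last: "us ! (length us - 1) = y"
    using path by (auto simp: graph_path_def hd_conv_nth last_conv_nth)
  have ext: "us ! Suc i extreme_point_of P" and "us ! i \<in> P"
    using path Suc.prems by (auto simp: graph_path_def extreme_point_of_def)
  have "us ! i \<noteq> us ! Suc i"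
    using path Suc.prems
    by (auto simp: graph_path_def successively_conv_nth dest: adjacent_imp_neq)
  then obtain G where G: "G facet_of P" "us ! Suc i \<in> G" "us ! i \<notin> G"
    using facet_separates_vertices[OF poly ext \<open>us ! i \<in> P\<close>] by metis
  have "x \<notin> G"
  proof
    assume "x \<in> G"
    with G first have "0 < i" by (cases i) auto
    with \<open>x \<in> G\<close> G first Suc.prems have "revisits us G"
      unfolding revisits_def by (metis lessI)
    with no_revisit G show False by blast
  qed
  moreover have "?N i \<subseteq> ?N (Suc i)"
  proof
    fix F assume "F \<in> ?N i"
    then have F: "F facet_of P" "us ! i \<in> F" "x \<notin> F" by auto
    then have "y \<in> F" using sp by (auto simp: spindle_def)
    show "F \<in> ?N (Suc i)"
    proof (rule ccontr)
      assume "\<not> ?thesis"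
      with F have out: "us ! Suc i \<notin> F" by blast
      with last \<open>y \<in> F\<close> have "Suc i \<noteq> length us - 1" by metis
      with Suc.prems have "Suc i < length us - 1" "length us - 1 < length us" by auto
      with F out last \<open>y \<in> F\<close> have "revisits us F"
        unfolding revisits_def by (metis lessI)
      with no_revisit F show False by blast
    qed
  qed
  ultimately have "?N i \<subset> ?N (Suc i)" using G by blast
  moreover have "finite (?N (Suc i))"
    by (rule finite_subset[OF _ finite_polyhedron_facets[OF poly]]) blast
  ultimately have "card (?N i) < card (?N (Suc i))" by (rule psubset_card_mono[rotated])
  with Suc show ?case by simp
qed simp

theorem lemma2p1:
  fixes P :: "'a::euclidean_space set" and x y :: 'a and d :: nat
  assumes "spindle d P x y"
    and "all_but_simple P x y"
    and "graph_dist P x y = enat (d + 1)"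
  shows "\<forall>us. graph_path P x us y \<longrightarrow> (\<exists>F. F facet_of P \<and> revisits us F)"
proof (intro allI impI, rule ccontr)
  fix us assume path: "graph_path P x us y"
    and "\<not> (\<exists>F. F facet_of P \<and> revisits us F)"
  then have no_revisit: "\<And>F. F facet_of P \<Longrightarrow> \<not> revisits us F" by blast
  have poly: "polyhedron P" and dim: "aff_dim P = int d"
    and "x \<noteq> y" "x \<in> P" "y \<in> P" and facets: "\<And>F. F facet_of P \<Longrightarrow> x \<in> F \<or> y \<in> F"
    using assms(1)
    by (auto simp: spindle_def polytope_imp_polyhedron extreme_point_of_def)
  have "enat (d + 1) \<le> enat (length us - 1)"
    unfolding assms(3)[symmetric] graph_dist_def using path by (intro INF_lower) simp
  then have len: "d + 2 \<le> length us" by simp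
  define m where "m = length us - 2"
  define w where "w = us ! m"
  have m: "d \<le> m" "Suc m < length us" "Suc m = length us - 1"
    using len by (auto simp: m_def)
  have "us ! Suc m = y"
    using path unfolding m(3) by (auto simp: graph_path_def last_conv_nth)
  moreover have "w extreme_point_of P" "adjacent P w (us ! Suc m)"
    using path m(2) unfolding w_def by (auto simp: graph_path_def successively_conv_nth)
  ultimately have w: "w extreme_point_of P" "w \<noteq> y"
    by (auto dest: adjacent_imp_neq)
  let ?N = "{F. F facet_of P \<and> w \<in> F \<and> x \<notin> F}" and ?A = "{F. F facet_of P \<and> w \<in> F}"
  have N: "m \<le> card ?N"
    using card_facets_avoiding_start[OF assms(1) path no_revisit] m by (simp add: w_def)
  \<comment> \<open>Two distinct vertices force \<open>d > 0\<close>, so some facet contains \<open>w\<close> but not \<open>x\<close>.\<close>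
  have "d \<noteq> 0"
  proof
    assume "d = 0"
    with dim obtain a where "P = {a}" by (auto simp: aff_dim_eq_0)
    with \<open>x \<noteq> y\<close> \<open>x \<in> P\<close> \<open>y \<in> P\<close> show False by blast
  qed
  with N m have "?N \<noteq> {}" by (metis card.empty le_zero_eq)
  then have "w \<noteq> x" by blast
  with w assms(2) dim have A: "card ?A = d"
    by (auto simp: all_but_simple_def simple_vertex_def)
  have "finite ?A"
    by (rule finite_subset[OF _ finite_polyhedron_facets[OF poly]]) blast
  with A N m have "?N = ?A" by (intro card_seteq) auto
  moreover obtain F where "F facet_of P" "w \<in> F" "y \<notin> F"
    using facet_separates_vertices[OF poly w(1) \<open>y \<in> P\<close> w(2)] .
  ultimately show False using facets by blast
qed

end
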